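(* Let $n > 3$ be an integer. Then the toric ideal $I_{S_n} \subset \mathbb{C}[x_\pi \mid \pi \in S_n]$ of the symmetric group $S_n$ at the permutation representation is generated in degree $n-1$; that is, $I_{S_n}$ has a generating set consisting of polynomials of total degree at most $n-1$.
   Context: Let $S_n$ be the symmetric group on $\{1,\dots,n\}$. Let $\rho$ be the permutation representation, sending $\pi \in S_n$ to its $n\times n$ permutation matrix, with entries $\rho_{ij}(\pi) = 1$ if $\pi(i)=j$ and $\rho_{ij}(\pi)=0$ otherwise. (Using the transposed convention only interchanges the names of the variables $t_{ij}$ and $t_{ji}$ below and gives the same ideal.) Let $\mathbb{C}[x_\pi \mid \pi\in S_n]$ be the polynomial ring in $n!$ variables indexed by $S_n$, with the standard grading in which each $x_\pi$ has degree 1. The toric ideal of $S_n$ at $\rho$ is $I_{S_n} = \ker \phi$, where $\phi$ is the $\mathbb{C}$-algebra homomorphism $$\phi \colon \mathbb{C}[x_\pi \mid \pi\in S_n] \longrightarrow \mathbb{C}[t_{ij}^{\pm 1} \mid 1\le i,j\le n], \qquad x_\pi \longmapsto \prod_{1\le i,j\le n} t_{ij}^{\rho_{ij}(\pi)} = \prod_{i=1}^n t_{i,\pi(i)}.$$ "Generated in degree $d$" means generated by elements of degree at most $d$. *)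

theory Defs
  imports "HOL-Algebra.Sym_Groups" "HOL-Algebra.RingHom" "HOL-Library.Poly_Mapping" Complex_Main
begin

section \<open>Polynomial and Laurent polynomial rings over the complex numbers\<close>

text \<open>
  A monomial is an exponent vector of finite support, and a (Laurent) polynomial is a finitely
  supported map from exponent vectors to complex coefficients.  Addition and the (convolution)
  product are those of the type \<open>poly_mapping\<close>.  The exponents are of type \<open>nat\<close> for
  polynomials and of type \<open>int\<close> for Laurent polynomials.
\<close>

type_synonym 'v cpoly = "('v \<Rightarrow>\<^sub>0 nat) \<Rightarrow>\<^sub>0 complex"
type_synonym 'v claurent = "('v \<Rightarrow>\<^sub>0 int) \<Rightarrow>\<^sub>0 complex"

text \<open>
  The ring of all elements in which only variables from \<open>V\<close> occur: for exponents in \<open>nat\<close> it is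
  the polynomial ring in the variables \<open>V\<close>, for exponents in \<open>int\<close> the Laurent polynomial ring.
\<close>

definition vars_ring :: "'v set \<Rightarrow> (('v \<Rightarrow>\<^sub>0 'e::comm_monoid_add) \<Rightarrow>\<^sub>0 complex) ring" where
  "vars_ring V = \<lparr>carrier = {f. \<forall>m\<in>Poly_Mapping.keys f. Poly_Mapping.keys m \<subseteq> V},
                  monoid.mult = (*), one = 1, zero = 0, add = (+)\<rparr>"

abbreviation poly_ring :: "'v set \<Rightarrow> 'v cpoly ring" where
  "poly_ring V \<equiv> vars_ring V"

abbreviation laurent_ring :: "'v set \<Rightarrow> 'v claurent ring" where
  "laurent_ring V \<equiv> vars_ring V"

definition Var :: "'v \<Rightarrow> ('v \<Rightarrow>\<^sub>0 'e::{comm_monoid_add,one}) \<Rightarrow>\<^sub>0 complex" where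
  "Var v = Poly_Mapping.single (Poly_Mapping.single v 1) 1"

definition Const :: "complex \<Rightarrow> ('v \<Rightarrow>\<^sub>0 'e::comm_monoid_add) \<Rightarrow>\<^sub>0 complex" where
  "Const c = Poly_Mapping.single 0 c"

text \<open>The total degree; by convention the zero polynomial has total degree 0.\<close>

definition total_degree :: "'v cpoly \<Rightarrow> nat" where
  "total_degree f =
     Max (insert 0 ((\<lambda>m. \<Sum>v\<in>Poly_Mapping.keys m. Poly_Mapping.lookup m v) ` Poly_Mapping.keys f))"

text \<open>
  The algebra homomorphism out of a polynomial ring that sends each variable \<open>v\<close> to \<open>h v\<close>
  (see \<open>poly_subst_ring_hom\<close>, \<open>poly_subst_Var\<close> and \<open>poly_subst_Const\<close> below).
\<close>

definition poly_subst ::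
    "('v \<Rightarrow> ('w \<Rightarrow>\<^sub>0 'e::comm_monoid_add) \<Rightarrow>\<^sub>0 complex) \<Rightarrow> 'v cpoly \<Rightarrow> ('w \<Rightarrow>\<^sub>0 'e) \<Rightarrow>\<^sub>0 complex" where
  "poly_subst h f = (\<Sum>m\<in>Poly_Mapping.keys f. Const (Poly_Mapping.lookup f m) *
      (\<Prod>v\<in>Poly_Mapping.keys m. h v ^ Poly_Mapping.lookup m v))"


section \<open>The toric ideal of the symmetric group\<close>

definition perm_matrix :: "(nat \<Rightarrow> nat) \<Rightarrow> nat \<Rightarrow> nat \<Rightarrow> nat" where
  "perm_matrix p i j = (if p i = j then 1 else 0)"

definition toric_hom :: "nat \<Rightarrow> (nat \<Rightarrow> nat) cpoly \<Rightarrow> (nat \<times> nat) claurent" where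
  "toric_hom n = poly_subst (\<lambda>p. \<Prod>i\<in>{1..n}. \<Prod>j\<in>{1..n}. Var (i, j) ^ perm_matrix p i j)"

definition toric_ideal :: "nat \<Rightarrow> (nat \<Rightarrow> nat) cpoly set" where
  "toric_ideal n =
     a_kernel (poly_ring (carrier (sym_group n))) (laurent_ring ({1..n} \<times> {1..n})) (toric_hom n)"


section \<open>Basic properties\<close>

lemma vars_ring_simps [simp]:
  "f \<in> carrier (vars_ring V) \<longleftrightarrow> (\<forall>m\<in>Poly_Mapping.keys f. Poly_Mapping.keys m \<subseteq> V)"
  "f \<otimes>\<^bsub>vars_ring V\<^esub> g = f * g" "f \<oplus>\<^bsub>vars_ring V\<^esub> g = f + g"
  "\<one>\<^bsub>vars_ring V\<^esub> = 1" "\<zero>\<^bsub>vars_ring V\<^esub> = 0"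
  by (simp_all add: vars_ring_def)

lemma vars_ring_add_closed:
  "f \<in> carrier (vars_ring V) \<Longrightarrow> g \<in> carrier (vars_ring V) \<Longrightarrow> f + g \<in> carrier (vars_ring V)"
  using Poly_Mapping.keys_add[of f g] by auto

lemma vars_ring_mult_closed:
  assumes "f \<in> carrier (vars_ring V)" "g \<in> carrier (vars_ring V)"
  shows "f * g \<in> carrier (vars_ring V)"
proof -
  have "Poly_Mapping.keys m \<subseteq> V" if m: "m \<in> Poly_Mapping.keys (f * g)" for m
  proof -
    obtain a b where ab: "m = a + b" "a \<in> Poly_Mapping.keys f" "b \<in> Poly_Mapping.keys g"
      using m Poly_Mapping.keys_mult[of f g] by blast
    then show ?thesis
      using assms Poly_Mapping.keys_add[of a b] by fastforce
  qed
  then show ?thesis by simp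
qed

lemma vars_ring_cring:
  fixes V :: "'v set"
  shows "cring (vars_ring V :: (('v \<Rightarrow>\<^sub>0 'e::comm_monoid_add) \<Rightarrow>\<^sub>0 complex) ring)" (is "cring ?R")
proof (rule cringI)
  show "abelian_group ?R"
  proof (rule abelian_groupI)
    fix x assume x: "x \<in> carrier ?R"
    have "Poly_Mapping.keys (- x) = Poly_Mapping.keys x"
      by (auto simp: in_keys_iff)
    with x have "- x \<in> carrier ?R" by simp
    moreover have "- x \<oplus>\<^bsub>?R\<^esub> x = \<zero>\<^bsub>?R\<^esub>" by simp
    ultimately show "\<exists>y\<in>carrier ?R. y \<oplus>\<^bsub>?R\<^esub> x = \<zero>\<^bsub>?R\<^esub>" by blast
  next
    fix x y assume "x \<in> carrier ?R" "y \<in> carrier ?R"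
    then show "x \<oplus>\<^bsub>?R\<^esub> y \<in> carrier ?R"
      unfolding vars_ring_simps(3) by (rule vars_ring_add_closed)
  qed (simp_all add: add.assoc add.commute)
  show "Group.comm_monoid ?R"
  proof (rule comm_monoidI)
    fix x y assume "x \<in> carrier ?R" "y \<in> carrier ?R"
    then show "x \<otimes>\<^bsub>?R\<^esub> y \<in> carrier ?R"
      unfolding vars_ring_simps(2) by (rule vars_ring_mult_closed)
  qed (simp_all add: mult.assoc mult.commute)
qed (simp add: distrib_right)

lemma Var_closed: "v \<in> V \<Longrightarrow> Var v \<in> carrier (vars_ring V)"
  by (auto simp: Var_def)

lemma Const_closed: "Const c \<in> carrier (vars_ring V)"
  by (auto simp: Const_def)

lemma Const_simps:
  "Const 0 = 0" "Const 1 = 1" "Const (a + b) = Const a + Const b" "Const (a * b) = Const a * Const b"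
  by (simp_all add: Const_def single_add mult_single)

lemma vars_ring_power_closed:
  "f \<in> carrier (vars_ring V) \<Longrightarrow> f ^ k \<in> carrier (vars_ring V)"
proof (induction k)
  case (Suc k)
  then show ?case unfolding power_Suc by (blast intro: vars_ring_mult_closed)
qed simp

lemma vars_ring_prod_closed:
  "(\<And>a. a \<in> A \<Longrightarrow> F a \<in> carrier (vars_ring V)) \<Longrightarrow> (\<Prod>a\<in>A. F a) \<in> carrier (vars_ring V)"
proof (induction A rule: infinite_finite_induct)
  case (insert x B)
  have "F x * prod F B \<in> carrier (vars_ring V)"
    by (rule vars_ring_mult_closed) (use insert in blast)+
  then show ?case by (subst prod.insert[OF insert.hyps])
qed simp_all

lemma vars_ring_sum_closed:
  "(\<And>a. a \<in> A \<Longrightarrow> F a \<in> carrier (vars_ring V)) \<Longrightarrow> (\<Sum>a\<in>A. F a) \<in> carrier (vars_ring V)"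
proof (induction A rule: infinite_finite_induct)
  case (insert x B)
  have "F x + sum F B \<in> carrier (vars_ring V)"
    by (rule vars_ring_add_closed) (use insert in blast)+
  then show ?case by (subst sum.insert[OF insert.hyps])
qed simp_all

lemma poly_subst_closed:
  assumes f: "f \<in> carrier (poly_ring V)" and h: "\<And>v. v \<in> V \<Longrightarrow> h v \<in> carrier (vars_ring W)"
  shows "poly_subst h f \<in> carrier (vars_ring W)"
  unfolding poly_subst_def
proof (intro vars_ring_sum_closed vars_ring_mult_closed Const_closed vars_ring_prod_closed
    vars_ring_power_closed h)
  fix m v assume "m \<in> Poly_Mapping.keys f" "v \<in> Poly_Mapping.keys m"
  then show "v \<in> V" using f by auto
qed

lemma poly_subst_superset:
  assumes "finite A" "Poly_Mapping.keys f \<subseteq> A"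
  shows "poly_subst h f = (\<Sum>m\<in>A. Const (Poly_Mapping.lookup f m) *
      (\<Prod>v\<in>Poly_Mapping.keys m. h v ^ Poly_Mapping.lookup m v))"
  unfolding poly_subst_def
  by (rule sum.mono_neutral_left) (use assms in \<open>auto simp: in_keys_iff Const_simps\<close>)

lemma poly_subst_add: "poly_subst h (f + g) = poly_subst h f + poly_subst h g"
proof -
  let ?A = "Poly_Mapping.keys f \<union> Poly_Mapping.keys g"
  have "Poly_Mapping.keys (f + g) \<subseteq> ?A" by (rule Poly_Mapping.keys_add)
  then show ?thesis
    by (simp add: poly_subst_superset[of ?A] lookup_add Const_simps distrib_right sum.distrib)
qed

lemma poly_subst_zero: "poly_subst h 0 = 0"
  by (simp add: poly_subst_def)

lemma poly_subst_sum: "poly_subst h (\<Sum>a\<in>A. F a) = (\<Sum>a\<in>A. poly_subst h (F a))"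
  by (induction A rule: infinite_finite_induct) (simp_all add: poly_subst_zero poly_subst_add)

lemma poly_subst_single:
  "poly_subst h (Poly_Mapping.single m c) =
     Const c * (\<Prod>v\<in>Poly_Mapping.keys m. h v ^ Poly_Mapping.lookup m v)"
  by (simp add: poly_subst_def Const_simps)

lemma poly_subst_Const: "poly_subst h (Const c) = Const c"
  using poly_subst_single[of h 0 c] by (simp add: Const_def)

lemma poly_subst_Var: "poly_subst h (Var v) = h v"
  unfolding Var_def by (simp add: poly_subst_single Const_simps)

lemma monomial_value_add:
  fixes h :: "'v \<Rightarrow> 'a::comm_monoid_mult" and a b :: "'v \<Rightarrow>\<^sub>0 nat"
  shows "(\<Prod>v\<in>Poly_Mapping.keys (a + b). h v ^ Poly_Mapping.lookup (a + b) v) =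
    (\<Prod>v\<in>Poly_Mapping.keys a. h v ^ Poly_Mapping.lookup a v) *
    (\<Prod>v\<in>Poly_Mapping.keys b. h v ^ Poly_Mapping.lookup b v)"
proof -
  let ?A = "Poly_Mapping.keys a \<union> Poly_Mapping.keys b"
  have *: "(\<Prod>v\<in>Poly_Mapping.keys m. h v ^ Poly_Mapping.lookup m v) =
      (\<Prod>v\<in>?A. h v ^ Poly_Mapping.lookup m v)" if "Poly_Mapping.keys m \<subseteq> ?A" for m
    by (rule prod.mono_neutral_left) (use that in \<open>auto simp: in_keys_iff\<close>)
  show ?thesis
    unfolding *[OF Poly_Mapping.keys_add] *[OF Un_upper1] *[OF Un_upper2]
    by (simp add: lookup_add power_add prod.distrib)
qed

lemma poly_mapping_sum_single:
  "f = (\<Sum>m\<in>Poly_Mapping.keys f. Poly_Mapping.single m (Poly_Mapping.lookup f m))"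
proof (rule poly_mapping_eqI)
  fix k
  have "(\<Sum>m\<in>Poly_Mapping.keys f. Poly_Mapping.lookup f m when m = k) = Poly_Mapping.lookup f k"
    by (simp add: when_def in_keys_iff)
  then show "Poly_Mapping.lookup f k =
      Poly_Mapping.lookup (\<Sum>m\<in>Poly_Mapping.keys f. Poly_Mapping.single m (Poly_Mapping.lookup f m)) k"
    by (simp add: lookup_sum lookup_single)
qed

lemma poly_subst_mult: "poly_subst h (f * g) = poly_subst h f * poly_subst h g"
proof -
  let ?s = "\<lambda>f m. Poly_Mapping.single m (Poly_Mapping.lookup f m)"
  have single: "poly_subst h (Poly_Mapping.single a c * Poly_Mapping.single b d) =
      poly_subst h (Poly_Mapping.single a c) * poly_subst h (Poly_Mapping.single b d)" for a b c d
    by (simp add: mult_single poly_subst_single monomial_value_add Const_simps algebra_simps)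
  have "poly_subst h (f * g) =
      poly_subst h ((\<Sum>a\<in>Poly_Mapping.keys f. ?s f a) * (\<Sum>b\<in>Poly_Mapping.keys g. ?s g b))"
    using poly_mapping_sum_single[of f] poly_mapping_sum_single[of g] by simp
  also have "\<dots> = poly_subst h (\<Sum>a\<in>Poly_Mapping.keys f. ?s f a) *
      poly_subst h (\<Sum>b\<in>Poly_Mapping.keys g. ?s g b)"
    by (simp add: sum_product poly_subst_sum single)
  finally show ?thesis
    using poly_mapping_sum_single[of f] poly_mapping_sum_single[of g] by simp
qed

lemma poly_subst_ring_hom:
  assumes "\<And>v. v \<in> V \<Longrightarrow> h v \<in> carrier (vars_ring W)"
  shows "poly_subst h \<in> ring_hom (poly_ring V) (vars_ring W)"
proof (rule ring_hom_memI)
  fix f assume "f \<in> carrier (poly_ring V)"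
  then show "poly_subst h f \<in> carrier (vars_ring W)"
    using assms by (rule poly_subst_closed)
next
  show "poly_subst h \<one>\<^bsub>poly_ring V\<^esub> = \<one>\<^bsub>vars_ring W\<^esub>"
    using poly_subst_Const[of h 1] by (simp add: Const_simps)
qed (simp_all add: poly_subst_add poly_subst_mult)

lemma toric_hom_ring_hom:
  "toric_hom n \<in> ring_hom (poly_ring (carrier (sym_group n))) (laurent_ring ({1..n} \<times> {1..n}))"
  unfolding toric_hom_def
  by (intro poly_subst_ring_hom vars_ring_prod_closed vars_ring_power_closed Var_closed) simp

lemma toric_hom_Var:
  assumes "p \<in> carrier (sym_group n)"
  shows "toric_hom n (Var p) = (\<Prod>i\<in>{1..n}. Var (i, p i))"
proof -
  have "(\<Prod>j\<in>{1..n}. Var (i, j) ^ perm_matrix p i j) = (Var (i, p i) :: (nat \<times> nat) claurent)"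
    if "i \<in> {1..n}" for i
  proof -
    have "p i \<in> {1..n}"
      using assms that permutes_in_image[of p "{1..n}" i] by (simp add: sym_group_carrier)
    moreover have "Var (i, j) ^ perm_matrix p i j =
        (if j = p i then Var (i, p i) else (1 :: (nat \<times> nat) claurent))" for j
      by (auto simp: perm_matrix_def)
    ultimately show ?thesis by simp
  qed
  then show ?thesis by (simp add: toric_hom_def poly_subst_Var)
qed

lemma toric_ideal_ideal: "ideal (toric_ideal n) (poly_ring (carrier (sym_group n)))"
proof -
  interpret ring_hom_ring "poly_ring (carrier (sym_group n))" "laurent_ring ({1..n} \<times> {1..n})"
      "toric_hom n"
    by (intro ring_hom_ringI2 cring.axioms(1) vars_ring_cring toric_hom_ring_hom)
  show ?thesis unfolding toric_ideal_def by (rule kernel_is_ideal)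
qed

end

theory Submission
  imports Defs "HOL-Library.Multiset"
begin

text \<open>
  Monomials in the \<open>x\<^sub>p\<close> are multisets of permutations, and a binomial lies in the toric ideal iff
  both multisets have the same image at every point.  Suppose two multisets with this property
  are given and \<open>q\<close> belongs to the second one.  If every point \<open>x\<close> has a \<open>p\<close> in a set \<open>W\<close> of
  members of the first one with \<open>p x = q x\<close>, then, by Hall's theorem, \<open>W\<close> can be exchanged for \<open>q\<close>
  and \<open>|W| - 1\<close> further permutations.  A set \<open>W\<close> of \<open>n - 1\<close> elements suffices as soon as some member
  of the first multiset agrees with \<open>q\<close> at two points.  To reach this situation, fix a point \<open>v\<close>,
  choose for each \<open>i \<noteq> v\<close> a member \<open>p\<^sub>i\<close> with \<open>p\<^sub>i i = q i\<close>, and regard the permutations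
  \<open>q\<^sup>-\<^sup>1 p\<^sub>i\<close> as a digraph with loops outside \<open>v\<close>.  A cycle of length at most \<open>n - 2\<close> through \<open>v\<close>,
  completed by loops, is a permutation \<open>t\<close> with two fixed points, and an exchange of these at most
  \<open>n - 1\<close> members produces \<open>q t\<close>.  If there is no such cycle, then the position of a point \<open>x\<close> on
  the \<open>(n-1)\<close>-cycle through \<open>v\<close> of \<open>q\<^sup>-\<^sup>1 p\<^sub>i\<close> does not depend on \<open>i\<close>; since the cycle of
  \<open>q\<^sup>-\<^sup>1 p\<^sub>i\<close> omits exactly \<open>i\<close>, all points other than \<open>v\<close> have the same position, which is
  impossible for \<open>n \<ge> 4\<close>.
\<close>

section \<open>Hall's theorem and regular families of multisets\<close>

text \<open>Induction on \<open>I\<close>. If some nonempty proper \<open>J\<close> is tight, it is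
  matched first and the rest is matched outside its neighbourhood. Otherwise every nonempty proper
  subset has a surplus, and one index may be matched arbitrarily.\<close>

lemma hall_marriage:
  assumes "finite I" and "\<And>i. i \<in> I \<Longrightarrow> finite (F i)"
    and "\<And>J. J \<subseteq> I \<Longrightarrow> card J \<le> card (\<Union>(F ` J))"
  shows "\<exists>f. (\<forall>i\<in>I. f i \<in> F i) \<and> inj_on f I"
  using assms
proof (induction I arbitrary: F rule: finite_psubset_induct)
  case (psubset I)
  have fin: "finite (\<Union>(F ` J))" if "J \<subseteq> I" for J
    using that psubset.hyps psubset.prems(1) by (meson finite_UN_I finite_subset subsetD)
  consider "I = {}"
    | J where "J \<subset> I" "J \<noteq> {}" "card J = card (\<Union>(F ` J))"
    | "I \<noteq> {}" "\<And>J. J \<subset> I \<Longrightarrow> J \<noteq> {} \<Longrightarrow> card J \<noteq> card (\<Union>(F ` J))"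
    by blast
  then show ?case
  proof cases
    case 1
    then show ?thesis by simp
  next
    case (2 J)
    define T where "T = \<Union>(F ` J)"
    have finT: "finite T" unfolding T_def using 2 by (intro fin) auto
    have "\<exists>f. (\<forall>i\<in>J. f i \<in> F i) \<and> inj_on f J"
      by (rule psubset.IH[OF 2(1)]) (use 2(1) psubset.prems in auto)
    then obtain f where f: "\<forall>i\<in>J. f i \<in> F i" "inj_on f J" by blast
    have "\<exists>g. (\<forall>i\<in>I - J. g i \<in> F i - T) \<and> inj_on g (I - J)"
    proof (rule psubset.IH)
      fix K assume K: "K \<subseteq> I - J"
      \<comment> \<open>Hall's condition for \<open>J \<union> K\<close>, with the equality for the
        tight set \<open>J\<close> subtracted, is the condition for \<open>K\<close> outside
        \<open>T\<close>.\<close>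
      have "card J + card K = card (J \<union> K)"
        using K 2 psubset.hyps by (subst card_Un_disjoint) (auto intro: finite_subset)
      also have "\<dots> \<le> card (\<Union>(F ` (J \<union> K)))"
        using K 2 by (intro psubset.prems) auto
      also have "\<Union>(F ` (J \<union> K)) = T \<union> (\<Union>i\<in>K. F i - T)"
        unfolding T_def by auto
      also have "card \<dots> = card T + card (\<Union>i\<in>K. F i - T)"
      proof (rule card_Un_disjoint[OF finT])
        show "finite (\<Union>i\<in>K. F i - T)"
          by (rule finite_subset[OF _ fin[of K]]) (use K in auto)
      qed auto
      finally show "card K \<le> card (\<Union>i\<in>K. F i - T)"
        using 2(3) T_def by simp
    qed (use 2 psubset.prems(1) in auto)
    then obtain g where g: "\<forall>i\<in>I - J. g i \<in> F i - T" "inj_on g (I - J)" by blast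
    define h where "h = (\<lambda>i. if i \<in> J then f i else g i)"
    have "\<forall>i\<in>I. h i \<in> F i" using f g unfolding h_def by auto
    moreover have "inj_on h I"
    proof (rule inj_onI)
      fix x y assume xy: "x \<in> I" "y \<in> I" "h x = h y"
      have T: "f i \<in> T" if "i \<in> J" for i using f(1) that unfolding T_def by blast
      show "x = y"
      proof (cases "x \<in> J \<longleftrightarrow> y \<in> J")
        case True
        then show ?thesis
          using xy f(2) g(2) inj_onD[of f J x y] inj_onD[of g "I - J" x y]
          by (cases "x \<in> J") (simp_all add: h_def)
      next
        case False
        then show ?thesis
          using xy T g(1) unfolding h_def by (metis DiffD2 DiffI)
      qed
    qed
    ultimately show ?thesis by blast
  next
    case 3
    then obtain i where i: "i \<in> I" by blast
    have "card {i} \<le> card (\<Union>(F ` {i}))" using i by (intro psubset.prems) auto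
    then obtain y where y: "y \<in> F i" by fastforce
    have "\<exists>g. (\<forall>j\<in>I - {i}. g j \<in> F j - {y}) \<and> inj_on g (I - {i})"
    proof (rule psubset.IH)
      fix K assume K: "K \<subseteq> I - {i}"
      show "card K \<le> card (\<Union>j\<in>K. F j - {y})"
      proof (cases "K = {}")
        case False
        have "K \<subset> I" using K i by auto
        then have "card K \<noteq> card (\<Union>(F ` K))" "card K \<le> card (\<Union>(F ` K))"
          using 3 False psubset.prems by auto
        \<comment> \<open>\<open>K\<close> is not tight, so it has at least one neighbour to spare
          and can afford to lose \<open>y\<close>.\<close>
        then have "card K \<le> card (\<Union>(F ` K)) - 1" by simp
        also have "\<dots> \<le> card (\<Union>(F ` K) - {y})"
          by (simp add: card_Diff_singleton_if)
        also have "\<Union>(F ` K) - {y} = (\<Union>j\<in>K. F j - {y})" by auto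
        finally show ?thesis .
      qed simp
    qed (use i psubset.prems(1) in auto)
    then obtain g where g: "\<forall>j\<in>I - {i}. g j \<in> F j - {y}" "inj_on g (I - {i})" by blast
    have "\<forall>j\<in>I. (g(i := y)) j \<in> F j" using g y by auto
    moreover have "inj_on (g(i := y)) I"
      using g unfolding inj_on_def by auto
    ultimately show ?thesis by blast
  qed
qed

text \<open>
  A \<open>k\<close>-regular bipartite multigraph on two copies of \<open>X\<close>: the multiset \<open>N x\<close> consists of the
  right neighbours of \<open>x\<close>.
\<close>

definition regular_family :: "'a set \<Rightarrow> nat \<Rightarrow> ('a \<Rightarrow> 'a multiset) \<Rightarrow> bool" where
  "regular_family X k N \<longleftrightarrow>
     (\<forall>x\<in>X. set_mset (N x) \<subseteq> X \<and> size (N x) = k) \<and> (\<forall>y\<in>X. (\<Sum>x\<in>X. count (N x) y) = k)"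

text \<open>Hall's condition follows by counting the edges that leave \<open>J\<close>: there are
  \<open>k * card J\<close> of them, and their right ends receive at most \<open>k\<close> each. An
  injection of the finite set \<open>X\<close> into itself is then a bijection.\<close>

lemma regular_family_matching:
  assumes "finite X" "regular_family X k N" "k > 0"
  shows "\<exists>q. q permutes X \<and> (\<forall>x\<in>X. q x \<in># N x)"
proof -
  have N: "\<And>x. x \<in> X \<Longrightarrow> set_mset (N x) \<subseteq> X" "\<And>x. x \<in> X \<Longrightarrow> size (N x) = k"
    "\<And>y. y \<in> X \<Longrightarrow> (\<Sum>x\<in>X. count (N x) y) = k"
    using assms(2) unfolding regular_family_def by auto
  have "card J \<le> card (\<Union>x\<in>J. set_mset (N x))" if J: "J \<subseteq> X" for J
  proof -
    let ?T = "\<Union>x\<in>J. set_mset (N x)"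
    have T: "?T \<subseteq> X" using N J by auto
    have finJ: "finite J" and finT: "finite ?T"
      using J T assms(1) by (auto intro: finite_subset)
    have "k * card J = (\<Sum>x\<in>J. size (N x))"
      using N J by (simp add: subset_iff)
    also have "\<dots> = (\<Sum>x\<in>J. \<Sum>y\<in>?T. count (N x) y)"
    proof (rule sum.cong[OF refl])
      fix x assume x: "x \<in> J"
      have "size (N x) = sum (count (N x)) (set_mset (N x))"
        by (simp add: size_multiset_overloaded_eq)
      also have "\<dots> = sum (count (N x)) ?T"
        using x finT by (intro sum.mono_neutral_left) (auto simp: not_in_iff)
      finally show "size (N x) = sum (count (N x)) ?T" .
    qed
    also have "\<dots> = (\<Sum>y\<in>?T. \<Sum>x\<in>J. count (N x) y)" by (rule sum.swap)
    also have "\<dots> \<le> (\<Sum>y\<in>?T. \<Sum>x\<in>X. count (N x) y)"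
      using J assms(1) by (intro sum_mono sum_mono2) auto
    also have "\<dots> = (\<Sum>y\<in>?T. k)" using N(3) T by (intro sum.cong) auto
    also have "\<dots> = k * card ?T" by simp
    finally show ?thesis using assms(3) by simp
  qed
  then obtain f where f: "\<forall>x\<in>X. f x \<in># N x" "inj_on f X"
    using hall_marriage[of X "\<lambda>x. set_mset (N x)"] assms(1) by auto
  then have im: "f ` X = X"
    using N(1) assms(1) by (intro endo_inj_surj) auto
  define q where "q = (\<lambda>x. if x \<in> X then f x else x)"
  have "bij_betw q X X"
    using im f(2) unfolding bij_betw_def q_def by (auto simp: inj_on_def)
  then have "q permutes X" by (rule bij_imp_permutes) (simp add: q_def)
  then show ?thesis using f(1) by (auto simp: q_def)
qed

text \<open>Deleting a perfect matching lowers every degree by one; on the right, \<open>y\<close>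
  loses exactly the edge from its preimage under \<open>q\<close>.\<close>

lemma regular_family_diff:
  assumes "finite X" "regular_family X (Suc k) N" "q permutes X" "\<And>x. x \<in> X \<Longrightarrow> q x \<in># N x"
  shows "regular_family X k (\<lambda>x. N x - {#q x#})"
  unfolding regular_family_def
proof (intro conjI ballI)
  fix x assume x: "x \<in> X"
  show "set_mset (N x - {#q x#}) \<subseteq> X"
    using assms(2) x by (auto simp: regular_family_def dest: in_diffD)
  show "size (N x - {#q x#}) = k"
    using assms x by (simp add: regular_family_def size_Diff_singleton)
next
  fix y assume y: "y \<in> X"
  have "(\<Sum>x\<in>X. count (N x) y) = (\<Sum>x\<in>X. count (N x - {#q x#}) y + (if q x = y then 1 else 0))"
    using assms(4) by (intro sum.cong refl) (auto simp: Suc_le_eq)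
  also have "\<dots> = (\<Sum>x\<in>X. count (N x - {#q x#}) y) + (\<Sum>x\<in>X. if q x = y then 1 else 0)"
    by (rule sum.distrib)
  also have "(\<Sum>x\<in>X. if q x = y then 1 else 0) = (\<Sum>x\<in>X. if x = inv' q y then 1 else (0::nat))"
    using assms(3) by (intro sum.cong refl) (auto simp: permutes_inverses)
  also have "\<dots> = 1"
    using y assms(1) permutes_in_image[OF permutes_inv[OF assms(3)]] by simp
  finally show "(\<Sum>x\<in>X. count (N x - {#q x#}) y) = k"
    using assms(2) y by (simp add: regular_family_def)
qed

section \<open>Multisets of permutations as regular families\<close>

definition perms :: "'a set \<Rightarrow> ('a \<Rightarrow> 'a) multiset \<Rightarrow> bool" where
  "perms X A \<longleftrightarrow> (\<forall>p\<in>#A. p permutes X)"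

lemma perms_simps [simp]:
  "perms X {#}" "perms X (add_mset p A) \<longleftrightarrow> p permutes X \<and> perms X A"
  "perms X (A + B) \<longleftrightarrow> perms X A \<and> perms X B"
  by (auto simp: perms_def)

text \<open>Koenig's decomposition: perfect matchings are split off one at a time.\<close>

lemma regular_family_decompose:
  assumes "finite X" "regular_family X k N"
  shows "\<exists>B. perms X B \<and> (\<forall>x\<in>X. image_mset (\<lambda>p. p x) B = N x)"
  using assms(2)
proof (induction k arbitrary: N)
  case 0
  then show ?case by (intro exI[of _ "{#}"]) (auto simp: regular_family_def)
next
  case (Suc k)
  obtain q where q: "q permutes X" "\<forall>x\<in>X. q x \<in># N x"
    using regular_family_matching[OF assms(1) Suc.prems] by auto
  with Suc obtain B where "perms X B" "\<forall>x\<in>X. image_mset (\<lambda>p. p x) B = N x - {#q x#}"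
    using regular_family_diff[OF assms(1) Suc.prems] by meson
  with q show ?case by (intro exI[of _ "add_mset q B"]) auto
qed

lemma regular_family_perms:
  assumes "finite X" "perms X A"
  shows "regular_family X (size A) (\<lambda>x. image_mset (\<lambda>p. p x) A)"
  unfolding regular_family_def
proof (intro conjI ballI)
  fix x assume x: "x \<in> X"
  show "set_mset (image_mset (\<lambda>p. p x) A) \<subseteq> X"
    using assms(2) x by (auto simp: perms_def permutes_in_image)
next
  fix y assume y: "y \<in> X"
  show "(\<Sum>x\<in>X. count (image_mset (\<lambda>p. p x) A) y) = size A"
    using assms(2)
  proof (induction A)
    case (add p A)
    have p: "p permutes X" using add by simp
    have "(\<Sum>x\<in>X. if p x = y then 1 else 0) = (\<Sum>x\<in>X. if x = inv' p y then 1 else (0::nat))"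
      using p by (intro sum.cong refl) (auto simp: permutes_inverses)
    also have "\<dots> = 1"
      using y assms(1) permutes_in_image[OF permutes_inv[OF p]] by simp
    finally have *: "(\<Sum>x\<in>X. if p x = y then 1 else 0) = (1::nat)" .
    have "(\<Sum>x\<in>X. count (image_mset (\<lambda>p. p x) (add_mset p A)) y) =
        (\<Sum>x\<in>X. (if p x = y then 1 else 0) + count (image_mset (\<lambda>p. p x) A) y)"
      by (intro sum.cong) auto
    also have "\<dots> = size (add_mset p A)"
      using add by (simp add: sum.distrib *)
    finally show ?case .
  qed simp
qed simp


section \<open>Moves between multisets of permutations\<close>

text \<open>The count of \<open>y\<close> in the image at \<open>x\<close> is the exponent of
  t_{xy}, so for \<open>X = {1..n}\<close> this says that two monomials have the same image under
  the toric map.\<close>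

definition same_marginals :: "'a set \<Rightarrow> ('a \<Rightarrow> 'b) multiset \<Rightarrow> ('a \<Rightarrow> 'b) multiset \<Rightarrow> bool" where
  "same_marginals X A B \<longleftrightarrow> (\<forall>x\<in>X. image_mset (\<lambda>p. p x) A = image_mset (\<lambda>p. p x) B)"

text \<open>The monomials of \<open>A\<close> and \<open>B\<close> differ by the monomial of
  \<open>C\<close> times a binomial of degree at most \<open>d\<close> whose two terms have equal
  marginals.\<close>

definition move :: "'a set \<Rightarrow> nat \<Rightarrow> ('a \<Rightarrow> 'a) multiset \<Rightarrow> ('a \<Rightarrow> 'a) multiset \<Rightarrow> bool" where
  "move X d A B \<longleftrightarrow> (\<exists>U V C. A = U + C \<and> B = V + C \<and> perms X U \<and> perms X V \<and> perms X C \<and>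
     size U \<le> d \<and> size V \<le> d \<and> same_marginals X U V)"

lemma in_marginal_iff: "y \<in># image_mset (\<lambda>p. p x) A \<longleftrightarrow> (\<exists>p\<in>#A. p x = y)"
  by auto

lemma same_marginals_size:
  assumes "same_marginals X A B" "X \<noteq> {}"
  shows "size A = size B"
  using assms unfolding same_marginals_def by (metis ex_in_conv size_image_mset)

lemma move_same_marginals: "move X d A B \<Longrightarrow> same_marginals X A B"
  by (auto simp: move_def same_marginals_def)

lemma move_add_mset:
  assumes "move X d A B" "p permutes X"
  shows "move X d (add_mset p A) (add_mset p B)"
proof -
  obtain U V C where "A = U + C" "B = V + C" "perms X U" "perms X V" "perms X C"
     "size U \<le> d" "size V \<le> d" "same_marginals X U V"
    using assms(1) unfolding move_def by blast
  with assms(2) show ?thesis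
    unfolding move_def by (intro exI[of _ U] exI[of _ V] exI[of _ "add_mset p C"]) simp
qed

lemma moves_add_mset:
  assumes "(move X d)\<^sup>*\<^sup>* A B" "p permutes X"
  shows "(move X d)\<^sup>*\<^sup>* (add_mset p A) (add_mset p B)"
  using assms(1)
  by (induction rule: rtranclp_induct)
    (auto intro: rtranclp.rtrancl_into_rtrancl move_add_mset assms(2))

text \<open>By the covering hypothesis \<open>r\<close> is a perfect matching in the regular family
  of \<open>A\<close>; what remains after its removal is regular again and decomposes into
  permutations.\<close>

lemma covered_perm_extract:
  assumes "finite X" "perms X A" "r permutes X" "\<And>x. x \<in> X \<Longrightarrow> \<exists>p\<in>#A. p x = r x" "A \<noteq> {#}"
  shows "\<exists>B. perms X B \<and> same_marginals X A (add_mset r B)"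
proof -
  obtain k where k: "size A = Suc k" using assms(5) by (metis size_eq_0_iff_empty not0_implies_Suc)
  let ?N = "\<lambda>x. image_mset (\<lambda>p. p x) A"
  have in_N: "r x \<in># ?N x" if "x \<in> X" for x
  proof -
    obtain p where "p \<in># A" "r x = p x" using assms(4)[OF \<open>x \<in> X\<close>] by metis
    then show ?thesis by auto
  qed
  have "regular_family X k (\<lambda>x. ?N x - {#r x#})"
    using regular_family_perms[OF assms(1,2)] k in_N
    by (intro regular_family_diff assms) simp_all
  from regular_family_decompose[OF assms(1) this]
  show ?thesis using in_N by (fastforce simp: same_marginals_def)
qed

text \<open>The extraction is applied to one copy of each member of \<open>W\<close> only, which
  bounds the degree of the move by \<open>card W\<close>; the other members of \<open>A\<close> form
  the common part \<open>C\<close>.\<close>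

lemma covered_perm_move:
  assumes "finite X" "X \<noteq> {}" "perms X A" "W \<subseteq> set_mset A" "card W \<le> d"
    and "r permutes X" "\<And>x. x \<in> X \<Longrightarrow> \<exists>p\<in>W. p x = r x"
  shows "\<exists>B. perms X B \<and> move X d A (add_mset r B)"
proof -
  let ?U = "mset_set W"
  have finW: "finite W" using assms(4) finite_subset by auto
  have "?U \<subseteq># A"
    using finW assms(4) by (auto simp: subseteq_mset_def count_mset_set' Suc_le_eq)
  then obtain C where C: "A = ?U + C" by (metis subset_mset.add_diff_inverse)
  have "\<exists>V. perms X V \<and> same_marginals X ?U (add_mset r V)"
  proof (rule covered_perm_extract)
    show "?U \<noteq> {#}" using assms(2,7) finW by (auto simp: mset_set_empty_iff)
  qed (use assms finW C in auto)
  then obtain V where V: "perms X V" "same_marginals X ?U (add_mset r V)" by blast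
  have "size (add_mset r V) = size ?U"
    using same_marginals_size[OF V(2) assms(2)] by simp
  then have "move X d A (add_mset r V + C)"
    unfolding move_def using V C assms
    by (intro exI[of _ ?U] exI[of _ "add_mset r V"] exI[of _ C]) auto
  then show ?thesis using V assms(3) C by (intro exI[of _ "V + C"]) auto
qed


section \<open>Permutations with two fixed points\<close>

text \<open>A shortest closed walk through \<open>v\<close> is a cycle \<open>C\<close>. The
  permutation \<open>t\<close> rotates \<open>C\<close> and uses loops elsewhere, which exist
  because \<open>v\<close> lies on \<open>C\<close>. Only points of \<open>C\<close> can be moved,
  and \<open>C\<close> has at most \<open>l\<close> points.\<close>

lemma closed_walk_permutation:
  assumes "finite X" "R \<subseteq> X \<times> X" "\<And>x. x \<in> X \<Longrightarrow> x \<noteq> v \<Longrightarrow> (x, x) \<in> R"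
    and "(v, v) \<in> R ^^ l" "l > 0"
  shows "\<exists>t. t permutes X \<and> (\<forall>x\<in>X. (x, t x) \<in> R) \<and> card X \<le> card {x \<in> X. t x = x} + l"
proof -
  define m where "m = (LEAST m. m > 0 \<and> (v, v) \<in> R ^^ m)"
  have m: "m > 0" "(v, v) \<in> R ^^ m" "m \<le> l"
    using LeastI[of "\<lambda>m. m > 0 \<and> (v, v) \<in> R ^^ m" l] Least_le[of _ l] assms(4,5)
    unfolding m_def by auto
  obtain f where f: "f 0 = v" "f m = v" "\<And>i. i < m \<Longrightarrow> (f i, f (Suc i)) \<in> R"
    using m(2) unfolding relpow_fun_conv by blast
  have walk: "(f a, f (a + b)) \<in> R ^^ b" if "a + b \<le> m" for a b
    using that f(3) unfolding relpow_fun_conv by (intro exI[of _ "\<lambda>i. f (a + i)"]) auto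
  \<comment> \<open>Cutting out the walk between two visits to one point would leave a closed walk
    of length \<open>a + (m - b)\<close>, which is positive but smaller than
    \<open>m\<close>.\<close>
  have "f a \<noteq> f b" if "a < b" "b < m" for a b
  proof
    assume "f a = f b"
    then have "(v, v) \<in> R ^^ (a + (m - b))"
      using walk[of 0 a] walk[of b "m - b"] that f(1,2) unfolding relpow_add by auto
    then have "m \<le> a + (m - b)"
      unfolding m_def by (rule_tac Least_le) (use that m_def in auto)
    then show False using that by simp
  qed
  then have inj: "inj_on f {..<m}"
    by (intro linorder_inj_onI) auto
  define C where "C = f ` {..<m}"
  define g where "g = the_inv_into {..<m} f"
  define t where "t = (\<lambda>x. if x \<in> C then f (Suc (g x)) else x)"
  have g: "g (f i) = i" if "i < m" for i
    unfolding g_def using inj that by (simp add: the_inv_into_f_f)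
  have t: "t (f i) = f (Suc i)" if "i < m" for i
    using g that unfolding t_def C_def by auto
  have CX: "C \<subseteq> X" using f(3) assms(2) unfolding C_def by auto
  have "t ` C = C"
  proof
    \<comment> \<open>For the last index the successor is \<open>f m = f 0\<close>, which closes the
      cycle.\<close>
    have "f (Suc i) \<in> C" if "i < m" for i
      using that f(1,2) m(1) unfolding C_def by (cases "Suc i = m") (auto simp: image_iff intro: bexI[of _ 0])
    then show "t ` C \<subseteq> C" using t unfolding C_def by auto
    show "C \<subseteq> t ` C"
    proof
      fix y assume "y \<in> C"
      then obtain i where i: "i < m" "y = f i" unfolding C_def by auto
      show "y \<in> t ` C"
      proof (cases i)
        case 0
        then have "y = t (f (m - 1))" using t[of "m - 1"] m(1) f i by simp
        then show ?thesis using m(1) unfolding C_def by auto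
      next
        case (Suc j)
        then have "y = t (f j)" using t[of j] i by simp
        then show ?thesis using Suc i unfolding C_def by auto
      qed
    qed
  qed
  moreover have "finite C" unfolding C_def by simp
  ultimately have "bij_betw t C C"
    by (simp add: bij_betw_def eq_card_imp_inj_on)
  then have "t permutes C" by (rule bij_imp_permutes) (simp add: t_def)
  then have "t permutes X" using CX by (rule permutes_subset)
  moreover have "(x, t x) \<in> R" if "x \<in> X" for x
  proof (cases "x \<in> C")
    case True
    then show ?thesis using t f(3) unfolding C_def by auto
  next
    case False
    then have "x \<noteq> v" using f(1) m(1) unfolding C_def by auto
    then show ?thesis using assms(3) that False by (simp add: t_def)
  qed
  moreover have "card X \<le> card {x \<in> X. t x = x} + l"
  proof -
    have "card X \<le> card ({x \<in> X. t x = x} \<union> C)"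
      using assms(1) \<open>finite C\<close> by (intro card_mono) (auto simp: t_def)
    also have "\<dots> \<le> card {x \<in> X. t x = x} + card C" by (rule card_Un_le)
    also have "card C \<le> l" unfolding C_def using card_image_le[of "{..<m}" f] m(3) by simp
    finally show ?thesis by simp
  qed
  ultimately show ?thesis by blast
qed

lemma short_closed_walk:
  fixes X :: "'a set" and v :: 'a and s :: "'a \<Rightarrow> 'a \<Rightarrow> 'a"
  defines "R \<equiv> {(x, y). x \<in> X \<and> (\<exists>i\<in>X - {v}. s i x = y)}"
  assumes fin: "finite X" and card: "card X \<ge> 4" and v: "v \<in> X"
    and s: "\<And>i. i \<in> X - {v} \<Longrightarrow> s i permutes X" "\<And>i. i \<in> X - {v} \<Longrightarrow> s i i = i"
  shows "\<exists>l. 0 < l \<and> l \<le> card X - 2 \<and> (v, v) \<in> R ^^ l"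
proof (rule ccontr)
  \<comment> \<open>With this value the positions \<open>0\<close> to \<open>N\<close> are exactly
    as many as the points of \<open>X - {i}\<close>.\<close>
  define N where "N = card X - 2"
  assume "\<not> ?thesis"
  then have no_walk: "(v, v) \<notin> R ^^ l" if "0 < l" "l \<le> N" for l
    using that unfolding N_def by blast
  have walk: "(x, (s i ^^ a) x) \<in> R ^^ a" if "i \<in> X - {v}" "x \<in> X" for i a x
  proof (induction a)
    case (Suc a)
    have "(s i ^^ a) x \<in> X"
      using permutes_funpow[OF s(1)[OF that(1)], of a] that(2) by (simp add: permutes_in_image)
    then have "((s i ^^ a) x, (s i ^^ Suc a) x) \<in> R"
      using that(1) unfolding R_def by auto
    with Suc show ?case by (rule relpow_Suc_I)
  qed simp
  have no_return: "(s i ^^ a) v \<noteq> v" if "i \<in> X - {v}" "0 < a" "a \<le> N" for i a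
    using walk[OF that(1) v, of a] no_walk that by metis
  have cancel: "(s i ^^ (b - a)) v = v" if "i \<in> X - {v}" "a \<le> b" "(s i ^^ a) v = (s i ^^ b) v" for i a b
  proof -
    have "(s i ^^ a) ((s i ^^ (b - a)) v) = (s i ^^ a) v"
      using that(2,3) by (metis comp_apply funpow_add le_add_diff_inverse)
    then show ?thesis
      using permutes_inj[OF permutes_funpow[OF s(1)[OF that(1)], of a]] by (auto dest: injD)
  qed
  have inj: "inj_on (\<lambda>a. (s i ^^ a) v) {..N}" if "i \<in> X - {v}" for i
  proof (rule linorder_inj_onI)
    fix a b assume "a < b" "a \<in> {..N}" "b \<in> {..N}"
    then show "(s i ^^ a) v \<noteq> (s i ^^ b) v"
      using cancel[OF that, of a b] no_return[OF that, of "b - a"] by auto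
  qed auto
  \<comment> \<open>The point \<open>i\<close> is fixed by \<open>s i\<close> and differs from
    \<open>v\<close>, so the orbit of \<open>v\<close> never reaches it.\<close>
  have avoid: "(s i ^^ a) v \<in> X - {i}" if "i \<in> X - {v}" for i a
  proof -
    have p: "s i ^^ a permutes X" using s(1)[OF that] by (rule permutes_funpow)
    have "(s i ^^ a) i = i" using s(2)[OF that] by (induction a) auto
    then have "(s i ^^ a) v \<noteq> i"
      using permutes_inj[OF p] that by (metis DiffE injD singletonI)
    then show ?thesis using p v by (simp add: permutes_in_image)
  qed
  have orbit: "(\<lambda>a. (s i ^^ a) v) ` {..N} = X - {i}" if "i \<in> X - {v}" for i
  proof (rule card_subset_eq)
    show "card ((\<lambda>a. (s i ^^ a) v) ` {..N}) = card (X - {i})"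
      using inj[OF that] that fin card by (simp add: card_image N_def)
  qed (use avoid[OF that] fin in auto)
  \<comment> \<open>Position \<open>Suc N\<close> must repeat some position \<open>a\<close>. If
    \<open>a > 0\<close>, cancelling \<open>a\<close> steps would give a return to \<open>v\<close>
    after at most \<open>N\<close> steps.\<close>
  have return: "(s i ^^ Suc N) v = v" if i: "i \<in> X - {v}" for i
  proof -
    obtain a where a: "a \<le> N" "(s i ^^ a) v = (s i ^^ Suc N) v"
      using avoid[OF i, of "Suc N"] orbit[OF i] by (metis (no_types, lifting) atMost_iff imageE)
    show ?thesis
    proof (cases "a = 0")
      case False
      then show ?thesis
        using cancel[OF i, of a "Suc N"] no_return[OF i, of "Suc N - a"] a by simp
    qed (use a in simp)
  qed
  \<comment> \<open>Going \<open>a\<close> steps along \<open>s i\<close> to the common point and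
    then home along \<open>s j\<close> would be a closed walk of length
    \<open>a + (Suc N - b)\<close>, which is at most \<open>N\<close>.\<close>
  have level_less: False
    if "i \<in> X - {v}" "j \<in> X - {v}" "a < b" "b \<le> N" "(s i ^^ a) v = (s j ^^ b) v" for i j a b
  proof -
    have "(s j ^^ (Suc N - b)) ((s i ^^ a) v) = v"
      using return[OF that(2)] that(4,5) by (metis comp_apply funpow_add le_SucI le_add_diff_inverse2)
    moreover have "(s i ^^ a) v \<in> X" using avoid[OF that(1), of a] by simp
    ultimately have "((s i ^^ a) v, v) \<in> R ^^ (Suc N - b)"
      using walk[OF that(2), of "(s i ^^ a) v" "Suc N - b"] by simp
    then have "(v, v) \<in> R ^^ (a + (Suc N - b))" (is "_ \<in> R ^^ ?l")
      using walk[OF that(1) v, of a] unfolding relpow_add by auto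
    moreover have "0 < ?l" "?l \<le> N" using that(3,4) by linarith+
    ultimately show False using no_walk[of ?l] by metis
  qed
  \<comment> \<open>The position of \<open>x\<close> on the orbits of \<open>v\<close>; by
    \<open>level_less\<close> it is the same on every orbit through \<open>x\<close>, so the choice
    does not matter.\<close>
  define lev where "lev = (\<lambda>x. SOME a. a \<le> N \<and> (\<exists>i\<in>X - {v}. (s i ^^ a) v = x))"
  have lev: "lev ((s i ^^ a) v) = a" if "i \<in> X - {v}" "a \<le> N" for i a
  proof -
    let ?P = "\<lambda>b. b \<le> N \<and> (\<exists>j\<in>X - {v}. (s j ^^ b) v = (s i ^^ a) v)"
    have P: "?P (lev ((s i ^^ a) v))"
      unfolding lev_def by (rule someI[of ?P a]) (use that in auto)
    then obtain j where j: "j \<in> X - {v}" "(s j ^^ lev ((s i ^^ a) v)) v = (s i ^^ a) v" by auto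
    show ?thesis
      using level_less[OF j(1) that(1) _ that(2) j(2)] level_less[OF that(1) j(1) _ _ j(2)[symmetric]] P
      by (meson linorder_neqE_nat)
  qed
  have lev_sum: "(\<Sum>x\<in>X - {i}. lev x) = \<Sum>{..N}" and lev_inj: "inj_on lev (X - {i})"
    if i: "i \<in> X - {v}" for i
  proof -
    show "(\<Sum>x\<in>X - {i}. lev x) = \<Sum>{..N}"
      unfolding orbit[OF i, symmetric] using inj[OF i] by (simp add: sum.reindex lev[OF i])
    show "inj_on lev (X - {i})"
      unfolding orbit[OF i, symmetric] by (rule inj_onI) (auto simp: lev[OF i])
  qed
  \<comment> \<open>Each \<open>X - {i}\<close> has the same level sum. Adding \<open>lev i\<close>
    gives the sum over all of \<open>X\<close>, so \<open>lev i\<close> cannot depend on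
    \<open>i\<close>.\<close>
  have lev_const: "lev i = lev j" if "i \<in> X - {v}" "j \<in> X - {v}" for i j
    using lev_sum[OF that(1)] lev_sum[OF that(2)] that
      sum.remove[OF fin, of i lev] sum.remove[OF fin, of j lev] by simp
  \<comment> \<open>Here four points are needed: besides the omitted \<open>i\<close>, two further
    points \<open>j\<close> and \<open>k\<close> other than \<open>v\<close> share a level, against
    injectivity on \<open>X - {i}\<close>.\<close>
  have "3 \<le> card (X - {v})" using card v by simp
  then obtain T where "T \<subseteq> X - {v}" "card T = 3" by (meson obtain_subset_with_card_n)
  then obtain i j k where "i \<in> X - {v}" "j \<in> X - {v}" "k \<in> X - {v}" "i \<noteq> j" "i \<noteq> k" "j \<noteq> k"
    by (auto simp: card_3_iff)
  then show False using lev_inj[of i] lev_const[of j k] by (auto dest: inj_onD)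
qed

text \<open>The loops required away from \<open>v\<close> come from \<open>s x x = x\<close>, and a
  closed walk of length at most \<open>card X - 2\<close> leaves two points fixed.\<close>

lemma exists_perm_two_fixpoints:
  assumes "finite X" "card X \<ge> 4" "v \<in> X"
    and "\<And>i. i \<in> X - {v} \<Longrightarrow> s i permutes X" "\<And>i. i \<in> X - {v} \<Longrightarrow> s i i = i"
  shows "\<exists>t a b. t permutes X \<and> (\<forall>x\<in>X. \<exists>i\<in>X - {v}. s i x = t x) \<and>
    a \<in> X \<and> b \<in> X \<and> a \<noteq> b \<and> t a = a \<and> t b = b"
proof -
  define R where "R = {(x, y). x \<in> X \<and> (\<exists>i\<in>X - {v}. s i x = y)}"
  obtain l where l: "0 < l" "l \<le> card X - 2" "(v, v) \<in> R ^^ l"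
    using short_closed_walk[OF assms] unfolding R_def by blast
  have "R \<subseteq> X \<times> X" using assms(4) unfolding R_def by (auto simp: permutes_in_image)
  moreover have "(x, x) \<in> R" if "x \<in> X" "x \<noteq> v" for x
    using that assms(5)[of x] unfolding R_def by auto
  ultimately obtain t where t: "t permutes X" "\<forall>x\<in>X. (x, t x) \<in> R"
      "card X \<le> card {x \<in> X. t x = x} + l"
    using closed_walk_permutation[of X R v l] assms(1) l by auto
  have "2 \<le> card {x \<in> X. t x = x}" using t(3) l(2) assms(2) by simp
  then obtain T where "T \<subseteq> {x \<in> X. t x = x}" "card T = 2" by (meson obtain_subset_with_card_n)
  then obtain a b where "a \<in> {x \<in> X. t x = x}" "b \<in> {x \<in> X. t x = x}" "a \<noteq> b"
    by (auto simp: card_2_iff)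
  with t(1,2) show ?thesis
    unfolding R_def by (intro exI[of _ t] exI[of _ a] exI[of _ b]) auto
qed


section \<open>Connectedness of the fibres\<close>

text \<open>Two moves suffice: the first creates a permutation that agrees with \<open>q\<close> at
  two points, the second uses it to create \<open>q\<close>.\<close>

lemma moves_to_common_perm:
  assumes X: "finite X" "card X \<ge> 4" and "perms X A" and q: "q permutes X"
    and cov: "\<And>x. x \<in> X \<Longrightarrow> \<exists>p\<in>#A. p x = q x"
  shows "\<exists>B. perms X B \<and> (move X (card X - 1))\<^sup>*\<^sup>* A (add_mset q B)"
proof -
  have ne: "X \<noteq> {}" using X by auto
  then obtain v where v: "v \<in> X" by blast
  have "\<exists>f. \<forall>x\<in>X. f x \<in># A \<and> f x x = q x" using cov by metis
  then obtain f where f: "\<And>x. x \<in> X \<Longrightarrow> f x \<in># A" "\<And>x. x \<in> X \<Longrightarrow> f x x = q x" by blast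
  have fp: "f x permutes X" if "x \<in> X" for x
    using f(1)[OF that] assms(3) by (auto simp: perms_def)
  \<comment> \<open>Composing with the inverse of \<open>q\<close> turns agreement with
    \<open>q\<close> at \<open>i\<close> into a fixed point at \<open>i\<close>.\<close>
  define s where "s = (\<lambda>i. inv' q \<circ> f i)"
  obtain t a b where t: "t permutes X" "\<forall>x\<in>X. \<exists>i\<in>X - {v}. s i x = t x"
    and ab: "a \<in> X" "b \<in> X" "a \<noteq> b" "t a = a" "t b = b"
  proof -
    have "s i permutes X" "s i i = i" if "i \<in> X - {v}" for i
      using that fp f(2) q
      by (auto simp: s_def permutes_inverses intro!: permutes_compose permutes_inv)
    then show ?thesis using exists_perm_two_fixpoints[OF X v, of s] that by blast
  qed
  let ?r = "q \<circ> t"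
  have "\<exists>B. perms X B \<and> move X (card X - 1) A (add_mset ?r B)"
  proof (rule covered_perm_move[OF X(1) ne assms(3)])
    show "f ` (X - {v}) \<subseteq> set_mset A" using f(1) by auto
    show "card (f ` (X - {v})) \<le> card X - 1"
      using card_image_le[of "X - {v}" f] X(1) v by simp
    show "?r permutes X" using t(1) q by (rule permutes_compose)
    fix x assume "x \<in> X"
    then obtain i where i: "i \<in> X - {v}" "s i x = t x" using t(2) by blast
    then have "f i x = ?r x" using q by (simp add: s_def permutes_inv_eq)
    then show "\<exists>p\<in>f ` (X - {v}). p x = ?r x" using i(1) by blast
  qed
  then obtain B where B: "perms X B" "move X (card X - 1) A (add_mset ?r B)" by blast
  have r: "?r permutes X" using t(1) q by (rule permutes_compose)
  \<comment> \<open>The first move keeps all marginals, so \<open>q\<close> is still covered after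
    it.\<close>
  have "\<exists>p\<in>#add_mset ?r B. p x = q x" if x: "x \<in> X" for x
  proof -
    have "q x \<in># image_mset (\<lambda>p. p x) A"
      using f[OF x] unfolding in_marginal_iff by blast
    also have "image_mset (\<lambda>p. p x) A = image_mset (\<lambda>p. p x) (add_mset ?r B)"
      using move_same_marginals[OF B(2)] x by (simp add: same_marginals_def)
    finally show ?thesis unfolding in_marginal_iff .
  qed
  then have "\<exists>g. \<forall>x\<in>X. g x \<in># add_mset ?r B \<and> g x x = q x" by metis
  then obtain g where g: "\<And>x. x \<in> X \<Longrightarrow> g x \<in># add_mset ?r B" "\<And>x. x \<in> X \<Longrightarrow> g x x = q x" by blast
  \<comment> \<open>The single element \<open>?r\<close> covers both \<open>a\<close> and
    \<open>b\<close>, so at most \<open>card X - 1\<close> elements cover \<open>q\<close>.\<close>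
  let ?W = "insert ?r (g ` (X - {a, b}))"
  have "\<exists>C. perms X C \<and> move X (card X - 1) (add_mset ?r B) (add_mset q C)"
  proof (rule covered_perm_move[OF X(1) ne _ _ _ q])
    show "perms X (add_mset ?r B)" using B(1) r by simp
    show "?W \<subseteq> set_mset (add_mset ?r B)" using g(1) by auto
    have "card (X - {a, b}) = card X - 2" using ab X(1) by (simp add: card_Diff_subset)
    then have "card (g ` (X - {a, b})) \<le> card X - 2"
      using card_image_le[of "X - {a, b}" g] X(1) by simp
    then show "card ?W \<le> card X - 1"
      using card_insert_le_m1[of "card X - 1" "g ` (X - {a, b})" ?r] X(2) by simp
    fix x assume x: "x \<in> X"
    show "\<exists>p\<in>?W. p x = q x"
    proof (cases "x = a \<or> x = b")
      case True
      then show ?thesis using ab by auto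
    next
      case False
      then show ?thesis using g(2)[OF x] x by blast
    qed
  qed
  then obtain C where "perms X C" "move X (card X - 1) (add_mset ?r B) (add_mset q C)" by blast
  then show ?thesis using B(2) by (meson converse_rtranclp_into_rtranclp r_into_rtranclp)
qed

text \<open>Induction on \<open>B\<close>: moves bring a member \<open>q\<close> of the target into
  \<open>A\<close>, the two copies of \<open>q\<close> cancel, and the moves for the remainder are
  carried out with \<open>q\<close> put back.\<close>

lemma same_marginals_moves:
  assumes "finite X" "card X \<ge> 4" "perms X A" "perms X B" "same_marginals X A B"
  shows "(move X (card X - 1))\<^sup>*\<^sup>* A B"
  using assms(3-)
proof (induction B arbitrary: A)
  case empty
  then show ?case using same_marginals_size[of X A "{#}"] assms(2) by fastforce
next
  case (add q B)
  have q: "q permutes X" "perms X B" using add.prems by auto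
  have "\<exists>p\<in>#A. p x = q x" if "x \<in> X" for x
  proof -
    have "q x \<in># image_mset (\<lambda>p. p x) A"
      using add.prems(3) that by (simp add: same_marginals_def)
    then show ?thesis unfolding in_marginal_iff .
  qed
  then obtain C where C: "perms X C" "(move X (card X - 1))\<^sup>*\<^sup>* A (add_mset q C)"
    using moves_to_common_perm[OF assms(1,2) add.prems(1) q(1)] by blast
  from C(2) have "same_marginals X A (add_mset q C)"
    by (induction rule: rtranclp_induct)
      (use move_same_marginals in \<open>fastforce simp: same_marginals_def\<close>)+
  then have "same_marginals X C B"
    using add.prems(3) by (simp add: same_marginals_def)
  then have "(move X (card X - 1))\<^sup>*\<^sup>* C B" using add.IH C(1) q(2) by blast
  then show ?case using C(2) moves_add_mset[OF _ q(1)] by (meson rtranclp_trans)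
qed

section \<open>Monomials and the toric ideal\<close>

definition exps :: "'v multiset \<Rightarrow> 'v \<Rightarrow>\<^sub>0 nat" where
  "exps A = (\<Sum>v\<in>#A. Poly_Mapping.single v 1)"

definition monom_of :: "'v multiset \<Rightarrow> 'v cpoly" where
  "monom_of A = (\<Prod>v\<in>#A. Var v)"

lemma lookup_exps: "Poly_Mapping.lookup (exps A) v = count A v"
  by (induction A) (auto simp: exps_def lookup_add lookup_single when_def)

lemma keys_exps: "Poly_Mapping.keys (exps A) = set_mset A"
  by (auto simp: in_keys_iff lookup_exps)

lemma exps_surj: "\<exists>A. exps A = m"
proof -
  have "finite {v. Poly_Mapping.lookup m v > 0}" by simp
  then have "count (Abs_multiset (Poly_Mapping.lookup m)) = Poly_Mapping.lookup m"
    by (rule count_Abs_multiset)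
  then have "exps (Abs_multiset (Poly_Mapping.lookup m)) = m"
    by (intro poly_mapping_eqI) (simp add: lookup_exps)
  then show ?thesis by blast
qed

lemma monom_of_eq_single: "monom_of A = Poly_Mapping.single (exps A) 1"
  by (induction A) (auto simp: monom_of_def exps_def Var_def mult_single)

lemma monom_of_add: "monom_of (A + B) = monom_of A * monom_of B"
  by (simp add: monom_of_def)

lemma monom_of_closed: "set_mset A \<subseteq> V \<Longrightarrow> monom_of A \<in> carrier (poly_ring V)"
  by (simp add: monom_of_eq_single keys_exps)

lemma monom_of_diff_closed:
  assumes "set_mset A \<subseteq> V" "set_mset B \<subseteq> V"
  shows "monom_of A - monom_of B \<in> carrier (poly_ring V)"
  using assms Poly_Mapping.keys_diff[of "monom_of A" "monom_of B"]
  by (fastforce simp: monom_of_eq_single keys_exps)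

lemma total_degree_monom_of_diff:
  assumes "size A \<le> d" "size B \<le> d"
  shows "total_degree (monom_of A - monom_of B) \<le> d"
proof -
  have "(\<Sum>v\<in>Poly_Mapping.keys m. Poly_Mapping.lookup m v) \<le> d"
    if "m \<in> Poly_Mapping.keys (monom_of A - monom_of B)" for m
  proof -
    have "m = exps A \<or> m = exps B"
      using that Poly_Mapping.keys_diff[of "monom_of A" "monom_of B"] by (auto simp: monom_of_eq_single)
    then show ?thesis
      using assms by (auto simp: keys_exps lookup_exps size_multiset_overloaded_eq)
  qed
  then show ?thesis unfolding total_degree_def by (subst Max_le_iff) auto
qed

text \<open>The exponent vector of the image of the monomial of \<open>A\<close>; its entries are
  the multiplicities in the marginals of \<open>A\<close>.\<close>

definition toric_weight :: "nat \<Rightarrow> (nat \<Rightarrow> nat) multiset \<Rightarrow> (nat \<times> nat) \<Rightarrow>\<^sub>0 int" where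
  "toric_weight n A = (\<Sum>p\<in>#A. \<Sum>i\<in>{1..n}. Poly_Mapping.single (i, p i) 1)"

lemma prod_Var:
  "(\<Prod>i\<in>I. Var (g i)) = (Poly_Mapping.single (\<Sum>i\<in>I. Poly_Mapping.single (g i) 1) 1
     :: ('w \<Rightarrow>\<^sub>0 'e::{comm_monoid_add,one}) \<Rightarrow>\<^sub>0 complex)"
  by (induction I rule: infinite_finite_induct) (auto simp: Var_def mult_single)

lemma toric_hom_monom_of:
  assumes "perms {1..n} A"
  shows "toric_hom n (monom_of A) = Poly_Mapping.single (toric_weight n A) 1"
  using assms
proof (induction A)
  case empty
  show ?case
    using poly_subst_Const[of _ 1] by (simp add: toric_hom_def toric_weight_def monom_of_def Const_simps)
next
  case (add p A)
  have "toric_hom n (monom_of (add_mset p A)) = toric_hom n (Var p) * toric_hom n (monom_of A)"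
    by (simp add: monom_of_def toric_hom_def poly_subst_mult)
  also have "toric_hom n (Var p) =
      Poly_Mapping.single (\<Sum>i\<in>{1..n}. Poly_Mapping.single (i, p i) 1) 1"
    using add.prems by (simp add: toric_hom_Var sym_group_carrier prod_Var)
  finally show ?case
    using add by (simp add: mult_single toric_weight_def)
qed

lemma lookup_toric_weight:
  assumes "i \<in> {1..n}"
  shows "Poly_Mapping.lookup (toric_weight n A) (i, j) = int (count (image_mset (\<lambda>p. p i) A) j)"
proof (induction A)
  case (add p A)
  have "Poly_Mapping.lookup (\<Sum>k\<in>{1..n}. Poly_Mapping.single (k, p k) (1::int)) (i, j) =
      (\<Sum>k\<in>{1..n}. if k = i then (if p i = j then 1 else 0) else 0)"
    unfolding lookup_sum by (intro sum.cong) (auto simp: lookup_single when_def)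
  also have "\<dots> = (if p i = j then 1 else 0)" using assms by simp
  finally show ?case using add by (simp add: toric_weight_def lookup_add)
qed (simp add: toric_weight_def)

lemma toric_weight_eq_imp_same_marginals:
  assumes "toric_weight n A = toric_weight n B"
  shows "same_marginals {1..n} A B"
  unfolding same_marginals_def
proof
  fix i assume "i \<in> {1..n}"
  then show "image_mset (\<lambda>p. p i) A = image_mset (\<lambda>p. p i) B"
    using lookup_toric_weight[of i n A] lookup_toric_weight[of i n B] assms
    by (intro multiset_eqI) simp
qed

section \<open>Binomials in the toric ideal\<close>

lemma in_toric_ideal_iff:
  "f \<in> toric_ideal n \<longleftrightarrow> f \<in> carrier (poly_ring (carrier (sym_group n))) \<and> toric_hom n f = 0"
  by (auto simp: toric_ideal_def a_kernel_def' simp del: vars_ring_simps(1))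

lemma toric_hom_diff: "toric_hom n (f - g) = toric_hom n f - toric_hom n g"
  unfolding toric_hom_def eq_diff_eq poly_subst_add[symmetric] by simp

lemma same_marginals_imp_toric_weight_eq:
  assumes "same_marginals {1..n} A B"
  shows "toric_weight n A = toric_weight n B"
proof -
  \<comment> \<open>Summing over positions before permutations expresses the weight through the
    marginals alone.\<close>
  have "toric_weight n C = (\<Sum>i\<in>{1..n}. \<Sum>y\<in>#image_mset (\<lambda>p. p i) C. Poly_Mapping.single (i, y) 1)" for C
    by (induction C) (auto simp: toric_weight_def sum.distrib)
  then show ?thesis using assms by (auto simp: same_marginals_def intro!: sum.cong)
qed

lemma binomial_in_toric_ideal:
  assumes "perms {1..n} A" "perms {1..n} B" "same_marginals {1..n} A B"
  shows "monom_of A - monom_of B \<in> toric_ideal n"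
  using assms same_marginals_imp_toric_weight_eq[OF assms(3)]
  unfolding in_toric_ideal_iff toric_hom_diff
  by (auto simp: toric_hom_monom_of perms_def sym_group_carrier simp del: vars_ring_simps(1)
      intro!: monom_of_diff_closed)

text \<open>Monomials of different weight have linearly independent images, so the coefficients of
  an element of the kernel add up to zero over each weight. Subtracting one representative monomial
  per weight then writes the element through binomials.\<close>

lemma toric_ideal_subset_ideal:
  assumes J: "ideal J (poly_ring (carrier (sym_group n)))"
    and binom: "\<And>A B. perms {1..n} A \<Longrightarrow> perms {1..n} B \<Longrightarrow> toric_weight n A = toric_weight n B \<Longrightarrow>
      monom_of A - monom_of B \<in> J"
  shows "toric_ideal n \<subseteq> J"
proof
  interpret J: ideal J "poly_ring (carrier (sym_group n))" by (rule J)
  have J_add: "a + b \<in> J" if "a \<in> J" "b \<in> J" for a b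
    using additive_subgroup.a_closed[OF J.additive_subgroup_axioms that] by simp
  have J_zero: "0 \<in> J" using additive_subgroup.zero_closed[OF J.additive_subgroup_axioms] by simp
  have J_sum: "sum F S \<in> J" if "\<And>a. a \<in> S \<Longrightarrow> F a \<in> J" for F S
    using that by (induction S rule: infinite_finite_induct) (auto intro: J_add J_zero)
  have J_mult: "a * b \<in> J" if "b \<in> J" "a \<in> carrier (poly_ring (carrier (sym_group n)))" for a b
    using J.I_l_closed[OF that] by simp
  fix f assume f: "f \<in> toric_ideal n"
  define K where "K = Poly_Mapping.keys f"
  define c where "c = Poly_Mapping.lookup f"
  define M :: "((nat \<Rightarrow> nat) \<Rightarrow>\<^sub>0 nat) \<Rightarrow> _" where "M = inv' exps"
  define w where "w = (\<lambda>m. toric_weight n (M m))"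
  \<comment> \<open>The chosen representative among the monomials of \<open>f\<close> with the
    weight of \<open>m\<close>.\<close>
  define r where "r = (\<lambda>m. inv_into K w (w m))"
  have exps_M: "exps (M m) = m" for m
    unfolding M_def using exps_surj[of m] by (metis f_inv_into_f rangeI)
  have perms_M: "perms {1..n} (M m)" if "m \<in> K" for m
  proof -
    have "Poly_Mapping.keys m \<subseteq> carrier (sym_group n)"
      using that f unfolding in_toric_ideal_iff K_def by simp
    then have "set_mset (M m) \<subseteq> carrier (sym_group n)"
      by (metis exps_M keys_exps)
    then show ?thesis by (auto simp: perms_def sym_group_carrier)
  qed
  have single: "Poly_Mapping.single m a = Const a * monom_of (M m)" for m a
    by (simp add: Const_def monom_of_eq_single mult_single exps_M)
  have f_eq: "f = (\<Sum>m\<in>K. Poly_Mapping.single m (c m))"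
    unfolding K_def c_def by (rule poly_mapping_sum_single)
  have "0 = toric_hom n f" using f by (simp add: in_toric_ideal_iff)
  also have "\<dots> = (\<Sum>m\<in>K. toric_hom n (Poly_Mapping.single m (c m)))"
    by (subst f_eq) (simp add: toric_hom_def poly_subst_sum)
  also have "\<dots> = (\<Sum>m\<in>K. Poly_Mapping.single (w m) (c m))"
  proof (rule sum.cong[OF refl])
    fix m assume m: "m \<in> K"
    have "toric_hom n (Poly_Mapping.single m (c m)) = Const (c m) * toric_hom n (monom_of (M m))"
      unfolding single by (simp add: toric_hom_def poly_subst_mult poly_subst_Const)
    then show "toric_hom n (Poly_Mapping.single m (c m)) = Poly_Mapping.single (w m) (c m)"
      using toric_hom_monom_of[OF perms_M[OF m]] by (simp add: Const_def mult_single w_def)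
  qed
  finally have zero: "(\<Sum>m\<in>K. Poly_Mapping.single (w m) (c m)) = 0" by simp
  have fibre: "(\<Sum>m\<in>{m \<in> K. w m = e}. c m) = 0" for e
  proof -
    have "0 = Poly_Mapping.lookup (\<Sum>m\<in>K. Poly_Mapping.single (w m) (c m)) e"
      by (simp add: zero)
    also have "\<dots> = (\<Sum>m\<in>K. if w m = e then c m else 0)"
      unfolding lookup_sum by (simp add: lookup_single when_def)
    also have "\<dots> = (\<Sum>m\<in>{m \<in> K. w m = e}. c m)"
      by (rule sum.inter_filter[symmetric]) (simp add: K_def)
    finally show ?thesis by simp
  qed
  have single_sum: "(\<Sum>m\<in>S. Poly_Mapping.single k (c m)) = Poly_Mapping.single k (\<Sum>m\<in>S. c m)"
    for S and k :: "(nat \<Rightarrow> nat) \<Rightarrow>\<^sub>0 nat"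
    by (induction S rule: infinite_finite_induct) (auto simp: single_add)
  \<comment> \<open>Replacing every monomial of \<open>f\<close> by its representative gives zero,
    so this sum may be subtracted from \<open>f\<close>.\<close>
  have "(\<Sum>m\<in>K. Poly_Mapping.single (r m) (c m)) =
      (\<Sum>e\<in>w ` K. \<Sum>m\<in>{m \<in> K. w m = e}. Poly_Mapping.single (r m) (c m))"
    by (rule sum.image_gen) (simp add: K_def)
  also have "\<dots> = (\<Sum>e\<in>w ` K. \<Sum>m\<in>{m \<in> K. w m = e}. Poly_Mapping.single (inv_into K w e) (c m))"
    by (intro sum.cong refl) (auto simp: r_def)
  also have "\<dots> = 0" by (simp add: single_sum fibre)
  finally have "f = (\<Sum>m\<in>K. Poly_Mapping.single m (c m)) - (\<Sum>m\<in>K. Poly_Mapping.single (r m) (c m))"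
    using f_eq by simp
  also have "\<dots> = (\<Sum>m\<in>K. Const (c m) * (monom_of (M m) - monom_of (M (r m))))"
    unfolding single sum_subtractf[symmetric] by (simp add: algebra_simps)
  also have "\<dots> \<in> J"
  proof (intro J_sum J_mult Const_closed binom)
    fix m assume m: "m \<in> K"
    show "perms {1..n} (M m)" using m by (rule perms_M)
    show "perms {1..n} (M (r m))" using m by (intro perms_M) (simp add: r_def inv_into_into)
    have "w (r m) = w m" using m unfolding r_def by (simp add: f_inv_into_f)
    then show "toric_weight n (M m) = toric_weight n (M (r m))" by (simp add: w_def)
  qed
  finally show "f \<in> J" .
qed

theorem theorem8:
  fixes n :: nat
  assumes "n > 3"
  shows "\<exists>G. G \<subseteq> carrier (poly_ring (carrier (sym_group n))) \<and>
             (\<forall>g\<in>G. total_degree g \<le> n - 1) \<and>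
             toric_ideal n = genideal (poly_ring (carrier (sym_group n))) G"
proof -
  let ?R = "poly_ring (carrier (sym_group n))"
  \<comment> \<open>All elements of the ideal of admissible degree are taken, so only the inclusion
    of the toric ideal in \<open>J\<close> needs the combinatorics.\<close>
  define G where "G = {g \<in> toric_ideal n. total_degree g \<le> n - 1}"
  interpret R: cring ?R by (rule vars_ring_cring)
  have G_closed: "G \<subseteq> carrier ?R" unfolding G_def in_toric_ideal_iff by blast
  define J where "J = genideal ?R G"
  interpret J: ideal J ?R unfolding J_def using G_closed by (rule R.genideal_ideal)
  have GJ: "G \<subseteq> J" unfolding J_def using G_closed by (rule R.genideal_self)
  have move_J: "monom_of A - monom_of B \<in> J" if AB: "move {1..n} (n - 1) A B" for A B
  proof -
    obtain U V C where *: "A = U + C" "B = V + C" "perms {1..n} U" "perms {1..n} V" "perms {1..n} C"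
      "size U \<le> n - 1" "size V \<le> n - 1" "same_marginals {1..n} U V"
      using AB unfolding move_def by blast
    then have "monom_of U - monom_of V \<in> J"
      using GJ binomial_in_toric_ideal total_degree_monom_of_diff unfolding G_def by blast
    moreover have "monom_of C \<in> carrier ?R"
      using *(5) by (intro monom_of_closed) (auto simp: perms_def sym_group_carrier)
    ultimately have "monom_of C * (monom_of U - monom_of V) \<in> J"
      using J.I_l_closed by fastforce
    then show ?thesis using *(1,2) by (simp add: monom_of_add algebra_simps)
  qed
  have "toric_ideal n \<subseteq> J"
  proof (rule toric_ideal_subset_ideal[OF J.is_ideal])
    fix A B assume AB: "perms {1..n} A" "perms {1..n} B" "toric_weight n A = toric_weight n B"
    then have "(move {1..n} (n - 1))\<^sup>*\<^sup>* A B"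
      using same_marginals_moves[of "{1..n}" A B] toric_weight_eq_imp_same_marginals assms by simp
    \<comment> \<open>The binomials of the single moves telescope along the chain.\<close>
    then show "monom_of A - monom_of B \<in> J"
    proof (induction rule: rtranclp_induct)
      case base
      show ?case using additive_subgroup.zero_closed[OF J.additive_subgroup_axioms] by simp
    next
      case (step C D)
      then show ?case
        using additive_subgroup.a_closed[OF J.additive_subgroup_axioms step.IH move_J[OF step.hyps(2)]]
        by simp
    qed
  qed
  moreover have "J \<subseteq> toric_ideal n"
    unfolding J_def by (rule R.genideal_minimal[OF toric_ideal_ideal]) (auto simp: G_def)
  ultimately show ?thesis using G_closed unfolding J_def G_def by blast
qed

end
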